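(* Let $P$ be a program with set of controlled inputs $\mathcal A$ and finite set of uncontrolled inputs $\mathcal X$, $O$ a set of finite traces (the target), $k$ a bound and $Q$ a threshold. If the algorithm QRSE, run on $P$ with bound $k$, target $O$ and threshold $Q$, reports $O$ with quantitative robustness $\chi$ (i.e. returns $(\text{true},\chi)$), then $q(P,O)\ge\chi$.
   Context: A program $P$ is a deterministic transition system: a set of states $\mathcal S$ with a transition relation $\to$ under which each state has at most one successor. An input of $P$ is a pair $(a,x)$ with $a\in\mathcal A$ (controlled input) and $x\in\mathcal X$ (uncontrolled input); $\mathcal A$ and $\mathcal X$ are nonempty and $\mathcal X$ is finite. Each input determines the initial state. A (finite) trace is a finite sequence of consecutive states respecting $\to$ starting from an initial state; $T(P)$ is the set of traces of $P$, and $T(P|_{(a,x)})$ is the set of traces of $P$ starting in the initial state determined by the input $(a,x)$. Each state has an associated location in the source of the program; a path is a finite sequence of locations, and a trace follows the path given by the sequence of locations of its states. For paths $\pi_1,\dots,\pi_n$, the restriction $P|^{\pi_1,\dots,\pi_n}$ of $P$ to these paths has as traces on input $(a,x)$ exactly those traces in $T(P|_{(a,x)})$ which follow one of $\pi_1,\dots,\pi_n$. Quantitative robustness of a program $P'$ (either $P$ or one of its restrictions): $$q(P',O)=\frac1{|\mathcal X|}\max_{a\in\mathcal A}\left|\left\{x\in\mathcal X\mid T(P'|_{(a,x)})\cap O\neq\varnothing\right\}\right|.$$ Oracle: for a path $\pi$, $\mathrm{ComputePQR}(P,\pi,O)$ returns the path-wise quantitative robustness $q(P|^{\pi},O)$.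 Algorithm QRSE (bound $k$, target $O$, threshold $Q$): enumerate the paths $\pi$ of $P$ of length at most $k$; for each one compute $\chi:=\mathrm{ComputePQR}(P,\pi,O)$ and, if $\chi\ge Q$, stop and return $(\text{true},\chi)$. If all paths have been enumerated without returning, return false. *)

theory Defs
  imports Complex_Main
begin

record ('s, 'a, 'x, 'l) program =
  states :: "'s set"
  trans :: "('s \<times> 's) set"
  controlled :: "'a set"
  uncontrolled :: "'x set"
  init :: "'a \<Rightarrow> 'x \<Rightarrow> 's"
  loc :: "'s \<Rightarrow> 'l"

definition wf_program :: "('s, 'a, 'x, 'l) program \<Rightarrow> bool" where
  "wf_program P \<longleftrightarrow>
     trans P \<subseteq> states P \<times> states P \<and> single_valued (trans P) \<and>
     controlled P \<noteq> {} \<and> uncontrolled P \<noteq> {} \<and> finite (uncontrolled P) \<and>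
     (\<forall>a\<in>controlled P. \<forall>x\<in>uncontrolled P. init P a x \<in> states P)"

text \<open>
  A trace contains at least its initial state. Traces need not be maximal, so the traces on
  one input are the nonempty prefixes of a single execution.
\<close>

definition traces_on :: "('s, 'a, 'x, 'l) program \<Rightarrow> 'a \<Rightarrow> 'x \<Rightarrow> 's list set" where
  "traces_on P a x =
     {t. t \<noteq> [] \<and> hd t = init P a x \<and> successively (\<lambda>s s'. (s, s') \<in> trans P) t}"

definition traces :: "('s, 'a, 'x, 'l) program \<Rightarrow> 's list set" where
  "traces P = (\<Union>a\<in>controlled P. \<Union>x\<in>uncontrolled P. traces_on P a x)"

definition paths :: "('s, 'a, 'x, 'l) program \<Rightarrow> 'l list set" where
  "paths P = lists (loc P ` states P)"

definition follows :: "('s, 'a, 'x, 'l) program \<Rightarrow> 's list \<Rightarrow> 'l list \<Rightarrow> bool" where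
  "follows P t \<pi> \<longleftrightarrow> map (loc P) t = \<pi>"

text \<open>
  The restriction of a program to some paths is specified by its traces on each input only;
  it is in general not itself a transition system. It keeps the inputs of the program.
\<close>

definition restricted_traces_on ::
    "('s, 'a, 'x, 'l) program \<Rightarrow> 'l list set \<Rightarrow> 'a \<Rightarrow> 'x \<Rightarrow> 's list set" where
  "restricted_traces_on P \<Pi> a x = {t \<in> traces_on P a x. \<exists>\<pi>\<in>\<Pi>. follows P t \<pi>}"

text \<open>
  Quantitative robustness, for a family \<open>T\<close> of trace sets indexed by the inputs
  \<open>A \<times> X\<close>, so that it applies both to programs and to their restrictions.
  The set \<open>A\<close> may be infinite; the maximum still ranges over a finite set, of numbers bounded
  by \<open>card X\<close>.
\<close>

definition quant_robustness ::
    "'a set \<Rightarrow> 'x set \<Rightarrow> ('a \<Rightarrow> 'x \<Rightarrow> 's list set) \<Rightarrow> 's list set \<Rightarrow> real" where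
  "quant_robustness A X T Tgt =
     1 / real (card X) * real (Max ((\<lambda>a. card {x \<in> X. T a x \<inter> Tgt \<noteq> {}}) ` A))"

definition q :: "('s, 'a, 'x, 'l) program \<Rightarrow> 's list set \<Rightarrow> real" where
  "q P Tgt = quant_robustness (controlled P) (uncontrolled P) (traces_on P) Tgt"

definition q_restricted ::
    "('s, 'a, 'x, 'l) program \<Rightarrow> 'l list set \<Rightarrow> 's list set \<Rightarrow> real" where
  "q_restricted P \<Pi> Tgt =
     quant_robustness (controlled P) (uncontrolled P) (restricted_traces_on P \<Pi>) Tgt"

definition compute_pqr ::
    "('s, 'a, 'x, 'l) program \<Rightarrow> 'l list \<Rightarrow> 's list set \<Rightarrow> real" where
  "compute_pqr P \<pi> Tgt = q_restricted P {\<pi>} Tgt"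

datatype qrse_result = Return_True real | Return_False

text \<open>
  The enumeration order is unspecified, so the algorithm is given by a big-step relation:
  \<open>W\<close> is the set of paths still to be enumerated, and any of them may come next.
\<close>

inductive qrse_loop ::
    "('s, 'a, 'x, 'l) program \<Rightarrow> 's list set \<Rightarrow> real \<Rightarrow> 'l list set \<Rightarrow> qrse_result \<Rightarrow> bool"
  for P :: "('s, 'a, 'x, 'l) program" and Tgt :: "'s list set" and Q :: real where
  report: "\<lbrakk>\<pi> \<in> W; \<chi> = compute_pqr P \<pi> Tgt; \<chi> \<ge> Q\<rbrakk>
      \<Longrightarrow> qrse_loop P Tgt Q W (Return_True \<chi>)"
| continue: "\<lbrakk>\<pi> \<in> W; \<chi> = compute_pqr P \<pi> Tgt; \<not> \<chi> \<ge> Q; qrse_loop P Tgt Q (W - {\<pi>}) r\<rbrakk>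
      \<Longrightarrow> qrse_loop P Tgt Q W r"
| exhausted: "qrse_loop P Tgt Q {} Return_False"

text \<open>
  \<open>qrse P k Tgt Q r\<close>: some run of the algorithm with bound \<open>k\<close>, target \<open>Tgt\<close> and
  threshold \<open>Q\<close> returns \<open>r\<close>.
\<close>

definition qrse ::
    "('s, 'a, 'x, 'l) program \<Rightarrow> nat \<Rightarrow> 's list set \<Rightarrow> real \<Rightarrow> qrse_result \<Rightarrow> bool" where
  "qrse P k Tgt Q r \<longleftrightarrow> qrse_loop P Tgt Q {\<pi> \<in> paths P. length \<pi> \<le> k} r"

end

theory Submission imports Defs begin

text \<open>
  Every value the algorithm reports is the robustness of a restriction of the program. For each
  controlled input, restricting shrinks the set of uncontrolled inputs that reach the target, and
  the maximum over the controlled inputs preserves this inequality.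
\<close>

lemma quant_robustness_mono:
  fixes T T' :: "'a \<Rightarrow> 'x \<Rightarrow> 's list set"
  assumes X: "finite X" and A: "A \<noteq> {}"
    and sub: "\<And>a x. a \<in> A \<Longrightarrow> x \<in> X \<Longrightarrow> T a x \<subseteq> T' a x"
  shows "quant_robustness A X T Tgt \<le> quant_robustness A X T' Tgt"
proof -
  let ?f = "\<lambda>T a. card {x \<in> X. T a x \<inter> Tgt \<noteq> {}}"
  \<comment> \<open>\<open>A\<close> may be infinite, but each count is at most
    \<open>card X\<close>, so \<open>Max\<close> ranges over a finite set.\<close>
  have fin: "finite (?f T ` A)" for T :: "'a \<Rightarrow> 'x \<Rightarrow> 's list set"
    by (rule finite_subset[of _ "{..card X}"]) (auto intro!: card_mono X)
  have "Max (?f T ` A) \<le> Max (?f T' ` A)"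
  proof (rule Max.boundedI[OF fin])
    fix n assume "n \<in> ?f T ` A"
    then obtain a where a: "a \<in> A" and n: "n = ?f T a" by blast
    have "n \<le> ?f T' a"
      unfolding n using X sub[OF a] by (intro card_mono) auto
    also have "\<dots> \<le> Max (?f T' ` A)"
      using a by (intro Max_ge[OF fin]) blast
    finally show "n \<le> Max (?f T' ` A)" .
  qed (use A in simp)
  then show ?thesis
    by (simp add: quant_robustness_def divide_right_mono)
qed

text \<open>Following a path only filters traces; well-formedness makes both maxima range over
  finite nonempty sets.\<close>

lemma q_restricted_le:
  assumes "wf_program P"
  shows "q_restricted P \<Pi> Tgt \<le> q P Tgt"
  using assms unfolding q_restricted_def q_def
  by (intro quant_robustness_mono) (auto simp: wf_program_def restricted_traces_on_def)

text \<open>Only \<open>report\<close> creates a \<open>Return_True\<close>; \<open>continue\<close>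
  passes on the result of a run on a subset of \<open>W\<close>, so the witness path stays in
  \<open>W\<close>.\<close>

lemma qrse_loop_Return_True:
  assumes "qrse_loop P Tgt Q W (Return_True \<chi>)"
  obtains \<pi> where "\<pi> \<in> W" and "\<chi> = compute_pqr P \<pi> Tgt"
  using assms by (induction W "Return_True \<chi>" rule: qrse_loop.induct) auto

theorem proposition5p1:
  fixes P :: "('s, 'a, 'x, 'l) program" and Tgt :: "'s list set"
    and k :: nat and Q \<chi> :: real
  assumes "wf_program P"
    and "Tgt \<subseteq> traces P"
    and "qrse P k Tgt Q (Return_True \<chi>)"
  shows "q P Tgt \<ge> \<chi>"
proof -
  obtain \<pi> where "\<chi> = compute_pqr P \<pi> Tgt"
    using assms(3) unfolding qrse_def by (rule qrse_loop_Return_True)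
  then show ?thesis
    using q_restricted_le[OF assms(1)] by (simp add: compute_pqr_def)
qed

end
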